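(* Let $a>0$ be a real number, and let $$P(x)=a_0+a_1\frac{x}{a}+a_2\frac{x(x-1)}{a(a+1)}+\ldots+a_n\frac{x(x-1)\cdots(x-n+1)}{a(a+1)\cdots(a+n-1)}$$ be a real polynomial with $a_n>0$ such that $Q=\mathcal{L}_a(P)$ has only real zeros, all lying in the segment $[-1,0]$. Put $\widetilde{Q}(x)=Q(-x)$. Then: 1. If there exists $k\in\{1,2,\ldots,n-1\}$ such that $P(k)=0$, then $P(0)=P(1)=\ldots=P(k-1)=0$. 2. For every $m\in\mathbb{N}$, $$P(-a-m)=\frac{1}{(a)_m x^{a-1}}\left(x^{a+m-1}\widetilde{Q}(x)\right)^{(m)}\Big|_{x=1},$$ where $^{(m)}$ denotes the $m$-th derivative with respect to $x$. 3. If there exists $l\in\mathbb{N}$ such that $P(-a-l)=0$, then $P(-a)=P(-a-1)=\ldots=P(-a-(l-1))=0$. 4. If $\deg P=2l+1$ with $l\in\mathbb{N}\cup\{0\}$, then $P$ has a root in the segment $[-a,0]$.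
   Context: $\mathbb{N}=\{1,2,3,\ldots\}$. For real $a>0$, $(a)_0=1$ and $(a)_k=a(a+1)\cdots(a+k-1)$ for $k\ge1$ is the Pochhammer symbol. The linear operator $\mathcal{L}_a:\mathbb{R}[x]\to\mathbb{R}[x]$ is defined by $\mathcal{L}_a\left(\sum_{k=0}^n a_k\frac{x(x-1)\cdots(x-k+1)}{(a)_k}\right)=\sum_{k=0}^n a_kx^k$ (the basis element for $k=0$ being $1$). "Has only real zeros lying in $[-1,0]$" means that every complex zero is real and belongs to $[-1,0]$. *)

theory Defs
  imports "HOL-Analysis.Analysis" "HOL-Computational_Algebra.Polynomial"
begin

definition ffact_basis :: "real \<Rightarrow> nat \<Rightarrow> real poly" where
  "ffact_basis a k = smult (1 / pochhammer a k) (\<Prod>i<k. [:- of_nat i, 1:])"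

(* For a > 0 the polynomials ffact_basis a k form a basis, so the expansion of P is unique up to
   trailing zero coefficients and the description below determines exactly one polynomial; see
   L_op_expansion, L_op_add, L_op_smult and ffact_basis_spans below. *)
definition L_op :: "real \<Rightarrow> real poly \<Rightarrow> real poly" where
  "L_op a P = (THE Q. \<exists>n c. P = (\<Sum>k\<le>n. smult (c k) (ffact_basis a k)) \<and>
                            Q = (\<Sum>k\<le>n. monom (c k) k))"

lemma poly_ffact_basis:
  "poly (ffact_basis a k) x = (\<Prod>i<k. x - real i) / pochhammer a k"
  by (simp add: ffact_basis_def poly_prod)

lemma ffact_basis_eval_eq_0: "j < k \<Longrightarrow> poly (ffact_basis a k) (real j) = 0"
  by (auto simp: poly_ffact_basis)

lemma ffact_basis_eval_neq_0: "a > 0 \<Longrightarrow> poly (ffact_basis a k) (real k) \<noteq> 0"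
  using pochhammer_pos[of a k] by (auto simp: poly_ffact_basis)

lemma ffact_basis_unique:
  assumes "a > 0"
    and "(\<Sum>k\<le>n. smult (c k) (ffact_basis a k)) = (\<Sum>k\<le>n. smult (d k) (ffact_basis a k))"
    and "j \<le> n"
  shows "c j = d j"
  using assms(3)
proof (induction j rule: less_induct)
  case (less j)
  let ?f = "\<lambda>k. (c k - d k) * poly (ffact_basis a k) (real j)"
  have "(\<Sum>k\<le>n. c k * poly (ffact_basis a k) (real j)) =
        (\<Sum>k\<le>n. d k * poly (ffact_basis a k) (real j))"
    using arg_cong[OF assms(2), of "\<lambda>p. poly p (real j)"] by (simp add: poly_sum)
  hence "0 = (\<Sum>k\<le>n. ?f k)"
    by (simp add: left_diff_distrib sum_subtractf)
  also have "\<dots> = (\<Sum>k\<in>{j}. ?f k)"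
  proof (rule sum.mono_neutral_right)
    show "\<forall>k\<in>{..n} - {j}. ?f k = 0"
    proof
      fix k assume k: "k \<in> {..n} - {j}"
      show "?f k = 0"
      proof (cases "k < j")
        case True
        thus ?thesis using less k by simp
      next
        case False
        thus ?thesis using k by (simp add: ffact_basis_eval_eq_0)
      qed
    qed
  qed (use less.prems in auto)
  finally show ?case
    using ffact_basis_eval_neq_0[OF assms(1), of j] by simp
qed

lemma sum_pad:
  fixes f :: "real \<Rightarrow> nat \<Rightarrow> real poly"
  assumes "n \<le> N" "\<And>k. f 0 k = 0"
  shows "(\<Sum>k\<le>N. f (if k \<le> n then c k else 0) k) = (\<Sum>k\<le>n. f (c k) k)"
proof -
  have "(\<Sum>k\<le>N. f (if k \<le> n then c k else 0) k) =
        (\<Sum>k\<le>n. f (if k \<le> n then c k else 0) k)"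
    using assms by (intro sum.mono_neutral_right) auto
  thus ?thesis by simp
qed

lemma L_op_expansion:
  assumes "a > 0"
  shows "L_op a (\<Sum>k\<le>n. smult (c k) (ffact_basis a k)) = (\<Sum>k\<le>n. monom (c k) k)"
  unfolding L_op_def
proof (rule the_equality)
  fix Q
  assume "\<exists>m d. (\<Sum>k\<le>n. smult (c k) (ffact_basis a k)) =
                 (\<Sum>k\<le>m. smult (d k) (ffact_basis a k)) \<and> Q = (\<Sum>k\<le>m. monom (d k) k)"
  then obtain m d where eq: "(\<Sum>k\<le>n. smult (c k) (ffact_basis a k)) =
      (\<Sum>k\<le>m. smult (d k) (ffact_basis a k))" and Q: "Q = (\<Sum>k\<le>m. monom (d k) k)"
    by blast
  let ?N = "max n m"
  let ?c = "\<lambda>k. if k \<le> n then c k else 0" and ?d = "\<lambda>k. if k \<le> m then d k else 0"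
  have "(\<Sum>k\<le>?N. smult (?c k) (ffact_basis a k)) = (\<Sum>k\<le>?N. smult (?d k) (ffact_basis a k))"
    using sum_pad[of n ?N "\<lambda>x k. smult x (ffact_basis a k)" c]
      sum_pad[of m ?N "\<lambda>x k. smult x (ffact_basis a k)" d] eq by simp
  hence cd: "?c k = ?d k" if "k \<le> ?N" for k
    by (rule ffact_basis_unique[OF assms]) (use that in auto)
  have "(\<Sum>k\<le>m. monom (d k) k) = (\<Sum>k\<le>?N. monom (?d k) k)"
    by (rule sum_pad[symmetric]) auto
  also have "\<dots> = (\<Sum>k\<le>?N. monom (?c k) k)"
    by (intro sum.cong refl arg_cong2[where f = monom]) (use cd in simp)
  also have "\<dots> = (\<Sum>k\<le>n. monom (c k) k)"
    by (rule sum_pad) auto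
  finally show "Q = (\<Sum>k\<le>n. monom (c k) k)" using Q by simp
qed blast

lemma ffact_basis_spans:
  assumes "a > 0"
  shows "\<exists>n c. P = (\<Sum>k\<le>n. smult (c k) (ffact_basis a k))"
proof -
  have "\<exists>c. P = (\<Sum>k\<le>n. smult (c k) (ffact_basis a k))" if "degree P \<le> n" for P n
    using that
  proof (induction n arbitrary: P)
    case 0
    then obtain b where "P = [:b:]" by (metis degree_eq_zeroE le_zero_eq)
    thus ?case by (intro exI[of _ "\<lambda>_. b"]) (simp add: ffact_basis_def)
  next
    case (Suc n)
    let ?B = "\<Prod>i<Suc n. [:- of_nat i, 1::real:]"
    have deg: "degree ?B = Suc n"
      by (subst degree_prod_eq_sum_degree) auto
    have lc: "coeff ?B (Suc n) = 1"
      using lead_coeff_prod[of "\<lambda>i. [:- of_nat i, 1::real:]" "{..<Suc n}"] deg by simp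
    define b where "b = coeff P (Suc n) * pochhammer a (Suc n)"
    have sm: "smult b (ffact_basis a (Suc n)) = smult (coeff P (Suc n)) ?B"
      using pochhammer_pos[OF assms, of "Suc n"] by (simp add: ffact_basis_def b_def)
    let ?R = "P - smult b (ffact_basis a (Suc n))"
    have "degree ?R \<le> n"
    proof (rule degree_le, intro allI impI)
      fix i assume i: "n < i"
      show "coeff ?R i = 0"
      proof (cases "i = Suc n")
        case True
        show ?thesis unfolding sm True by (simp add: lc del: prod.lessThan_Suc)
      next
        case False
        hence "coeff P i = 0" "coeff ?B i = 0"
          using i Suc.prems deg by (auto intro!: coeff_eq_0 simp del: prod.lessThan_Suc)
        thus ?thesis unfolding sm by (simp del: prod.lessThan_Suc)
      qed
    qed
    from Suc.IH[OF this] obtain c where c: "?R = (\<Sum>k\<le>n. smult (c k) (ffact_basis a k))"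
      by blast
    have "P = ?R + smult b (ffact_basis a (Suc n))" by simp
    also have "\<dots> = (\<Sum>k\<le>Suc n. smult ((c(Suc n := b)) k) (ffact_basis a k))"
      unfolding c by simp
    finally show ?case by blast
  qed
  thus ?thesis by blast
qed

lemma smult_sum_poly: "smult r (\<Sum>k\<in>A. f k) = (\<Sum>k\<in>A. smult r (f k :: real poly))"
  by (induction A rule: infinite_finite_induct) (simp_all add: smult_add_right)

lemma L_op_smult:
  assumes "a > 0"
  shows "L_op a (smult r P) = smult r (L_op a P)"
proof -
  obtain n c where P: "P = (\<Sum>k\<le>n. smult (c k) (ffact_basis a k))"
    using ffact_basis_spans[OF assms] by blast
  have "smult r P = (\<Sum>k\<le>n. smult (r * c k) (ffact_basis a k))"
    by (simp add: P smult_sum_poly)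
  thus ?thesis
    by (simp add: P L_op_expansion[OF assms] smult_sum_poly smult_monom)
qed

lemma L_op_add:
  assumes "a > 0"
  shows "L_op a (P + R) = L_op a P + L_op a R"
proof -
  obtain n c where P: "P = (\<Sum>k\<le>n. smult (c k) (ffact_basis a k))"
    using ffact_basis_spans[OF assms] by blast
  obtain m d where R: "R = (\<Sum>k\<le>m. smult (d k) (ffact_basis a k))"
    using ffact_basis_spans[OF assms] by blast
  let ?N = "max n m"
  let ?c = "\<lambda>k. if k \<le> n then c k else 0" and ?d = "\<lambda>k. if k \<le> m then d k else 0"
  have P': "P = (\<Sum>k\<le>?N. smult (?c k) (ffact_basis a k))"
    unfolding P by (rule sum_pad[symmetric]) auto
  have R': "R = (\<Sum>k\<le>?N. smult (?d k) (ffact_basis a k))"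
    unfolding R by (rule sum_pad[symmetric]) auto
  have "P + R = (\<Sum>k\<le>?N. smult (?c k + ?d k) (ffact_basis a k))"
    by (subst P', subst R') (simp only: sum.distrib[symmetric] smult_add_left)
  hence "L_op a (P + R) = (\<Sum>k\<le>?N. monom (?c k + ?d k) k)"
    by (simp only: L_op_expansion[OF assms])
  also have "\<dots> = (\<Sum>k\<le>?N. monom (?c k) k) + (\<Sum>k\<le>?N. monom (?d k) k)"
    by (simp only: sum.distrib[symmetric] add_monom)
  also have "\<dots> = L_op a P + L_op a R"
    by (subst P', subst R') (simp only: L_op_expansion[OF assms])
  finally show ?thesis .
qed

end

theory Submission
  imports Defs "HOL-Computational_Algebra.Fundamental_Theorem_Algebra"
    "HOL-Computational_Algebra.Formal_Power_Series"
begin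

text \<open>
  The argument rests on two observations.

  First, \<open>Q\<close> splits over the reals into linear factors \<open>x - r\<close> with \<open>-1 \<le> r \<le> 0\<close>, so its
  coefficients, which are the coefficients of \<open>P\<close> in the rescaled falling factorial basis, are
  nonnegative. At a natural number \<open>k\<close> all basis polynomials are nonnegative, and those of index at
  most \<open>k\<close> are positive. Hence \<open>P(k) = 0\<close> forces the coefficients with index at most \<open>k\<close> to vanish,
  and these are the only ones that contribute to \<open>P(0), \<dots>, P(k)\<close>.

  Second, the operator intertwines two reflections: it sends \<open>P(-a-x)\<close> to \<open>Q(-1-x)\<close>
  (\<open>L_op_reflect\<close>). On basis polynomials this is the Chu-Vandermonde identity set against the
  binomial expansion of \<open>(1+x)^k\<close>. The reflection \<open>x \<mapsto> -1-x\<close> preserves the segment \<open>[-1,0]\<close>, so up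
  to the sign \<open>(-1)^n\<close> the polynomial \<open>Q(-1-x)\<close> has nonnegative coefficients as well. Applied to the
  reflected polynomial, the first observation yields the statement on the zeros \<open>-a-l\<close>.

  The case of odd degree \<open>n\<close> also follows: \<open>P(0) = Q(0) \<ge> 0\<close>, whereas \<open>P(-a) = Q(-1)\<close> has the sign of
  \<open>(-1)^n\<close> or is zero, so the intermediate value theorem applies. The formula for \<open>P(-a-m)\<close> is a
  comparison of coefficients: the \<open>m\<close>-th derivative of \<open>x powr (a+k+m-1)\<close> at \<open>1\<close> is
  \<open>pochhammer (a+k) m\<close>, and \<open>(a)_m (a+m)_k = (a)_k (a+k)_m\<close>.
\<close>

section \<open>Real-rooted polynomials\<close>

lemma poly_map_of_real_linear_mult:
  "poly (map_poly complex_of_real ([:b, d:] * q)) z =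
     (of_real b + of_real d * z) * poly (map_poly complex_of_real q) z"
proof -
  have "map_poly complex_of_real ([:b, d:] * q) =
          [:of_real b, of_real d:] * map_poly complex_of_real q"
    by (rule poly_eqI) (simp add: coeff_map_poly coeff_pCons split: nat.split)
  then show ?thesis by (simp add: algebra_simps)
qed

lemma poly_map_of_real_of_real:
  "poly (map_poly complex_of_real p) (of_real x) = of_real (poly p x)"
  by (induction p) (simp_all add: map_poly_pCons)

lemma real_rooted_factorization:
  fixes p :: "real poly"
  assumes "\<forall>z::complex. poly (map_poly complex_of_real p) z = 0 \<longrightarrow> z \<in> complex_of_real ` S"
  shows "\<exists>rs. set rs \<subseteq> S \<and> length rs = degree p \<and>
    p = smult (lead_coeff p) (\<Prod>r\<leftarrow>rs. [:-r, 1:])"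
  using assms
proof (induction "degree p" arbitrary: p)
  case 0
  then obtain b where "p = [:b:]" by (metis degree_eq_zeroE)
  then show ?case by (intro exI[of _ "[]"]) simp
next
  case (Suc d)
  have "degree (map_poly complex_of_real p) = degree p"
    by (rule degree_map_poly) simp
  then have "\<not> constant (poly (map_poly complex_of_real p))"
    using Suc.hyps(2) by (simp add: constant_degree)
  then obtain z where "poly (map_poly complex_of_real p) z = 0"
    using fundamental_theorem_of_algebra by blast
  then obtain r where r: "r \<in> S" "poly (map_poly complex_of_real p) (of_real r) = 0"
    using Suc.prems by blast
  then have "poly p r = 0" by (simp add: poly_map_of_real_of_real)
  then obtain q where q: "p = [:-r, 1:] * q" by (auto simp: poly_eq_0_iff_dvd)
  from Suc.hyps(2) q have "q \<noteq> 0" by auto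
  then have "degree p = Suc (degree q)" unfolding q by (subst degree_mult_eq) auto
  then have "d = degree q" using Suc.hyps(2) by simp
  moreover have "\<forall>z. poly (map_poly complex_of_real q) z = 0 \<longrightarrow> z \<in> complex_of_real ` S"
    using Suc.prems unfolding q poly_map_of_real_linear_mult by simp
  ultimately obtain rs where rs: "set rs \<subseteq> S" "length rs = degree q"
    "q = smult (lead_coeff q) (\<Prod>r\<leftarrow>rs. [:-r, 1:])"
    using Suc.hyps(1) by blast
  have "lead_coeff p = lead_coeff q" unfolding q by (subst lead_coeff_mult) simp
  then have "q = smult (lead_coeff p) (\<Prod>r\<leftarrow>rs. [:-r, 1:])"
    using rs(3) by simp
  then have "[:-r, 1:] * q = smult (lead_coeff p) ([:-r, 1:] * (\<Prod>r\<leftarrow>rs. [:-r, 1:]))"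
    by (metis mult_smult_right)
  then have "p = smult (lead_coeff p) (\<Prod>r\<leftarrow>(r # rs). [:-r, 1:])"
    using q by (simp only: list.map prod_list.Cons)
  then show ?case
    using r rs(1,2) \<open>degree p = Suc (degree q)\<close>
    by (intro exI[of _ "r # rs"]) auto
qed

lemma coeff_prod_linear_nonneg:
  fixes rs :: "'a list" and f :: "'a \<Rightarrow> real"
  assumes "\<forall>r\<in>set rs. f r \<ge> 0"
  shows "coeff (\<Prod>r\<leftarrow>rs. [:f r, 1:]) k \<ge> 0"
  using assms
  by (induction rs arbitrary: k) (auto simp: coeff_pCons coeff_1 split: nat.split)

text \<open>
  The two polynomials have the roots \<open>r\<close> and \<open>-1-r\<close> respectively, all in \<open>[-1,0]\<close>. The sign corrects
  the leading coefficient of the second one.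
\<close>
lemma roots_in_unit_segment_coeff_nonneg:
  fixes Q :: "real poly"
  assumes roots: "\<forall>z::complex. poly (map_poly complex_of_real Q) z = 0 \<longrightarrow>
      z \<in> complex_of_real ` {-1..0}"
    and lc: "lead_coeff Q \<ge> 0"
  shows "coeff Q k \<ge> 0"
    and "coeff (smult ((-1) ^ degree Q) (pcompose Q [:-1, -1:])) k \<ge> 0"
proof -
  obtain rs where rs: "set rs \<subseteq> {-1..0}" "length rs = degree Q"
    and Q: "Q = smult (lead_coeff Q) (\<Prod>r\<leftarrow>rs. [:-r, 1:])"
    using real_rooted_factorization[OF roots] by blast
  have "coeff (\<Prod>r\<leftarrow>rs. [:-r, 1:]) k \<ge> 0"
    by (rule coeff_prod_linear_nonneg) (use rs in auto)
  then show "coeff Q k \<ge> 0" using lc by (subst Q) simp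
  have "pcompose (\<Prod>r\<leftarrow>rs. [:-r, 1:]) [:-1, -1:] =
      smult ((-1) ^ length rs) (\<Prod>r\<leftarrow>rs. [:1 + r, 1:])"
  proof (induction rs)
    case (Cons r rs)
    have "pcompose [:-r, 1:] [:-1, -1:] = smult (-1) [:1 + r, 1:]"
      by (simp add: pcompose_pCons)
    with Cons show ?case
      by (simp only: list.map prod_list.Cons pcompose_mult list.size power_Suc mult_smult_left
          mult_smult_right smult_smult add_0_right add_Suc_right mult.commute)
  qed (simp add: pcompose_1)
  then have "pcompose Q [:-1, -1:] =
      smult (lead_coeff Q * (-1) ^ degree Q) (\<Prod>r\<leftarrow>rs. [:1 + r, 1:])"
    by (subst Q) (simp add: pcompose_smult rs(2))
  then have "smult ((-1) ^ degree Q) (pcompose Q [:-1, -1:]) =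
      smult (lead_coeff Q * ((-1) ^ degree Q * (-1) ^ degree Q)) (\<Prod>r\<leftarrow>rs. [:1 + r, 1:])"
    by (simp only: smult_smult mult_ac)
  also have "(-1) ^ degree Q * (-1) ^ degree Q = (1::real)"
    by (simp flip: power_mult_distrib)
  finally have "smult ((-1) ^ degree Q) (pcompose Q [:-1, -1:]) =
      smult (lead_coeff Q) (\<Prod>r\<leftarrow>rs. [:1 + r, 1:])"
    by simp
  moreover have "coeff (\<Prod>r\<leftarrow>rs. [:1 + r, 1:]) k \<ge> 0"
    by (rule coeff_prod_linear_nonneg) (use rs in auto)
  ultimately show "coeff (smult ((-1) ^ degree Q) (pcompose Q [:-1, -1:])) k \<ge> 0"
    using lc by simp
qed

section \<open>The basis and the operator\<close>

lemma degree_ffact_basis: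
  assumes "a > 0"
  shows "degree (ffact_basis a k) = k"
proof -
  have "degree (\<Prod>i<k. [:- of_nat i, 1 :: real:]) = k"
    by (subst degree_prod_eq_sum_degree) auto
  then show ?thesis
    using pochhammer_pos[OF assms, of k] by (simp add: ffact_basis_def)
qed

lemma poly_ffact_basis_gbinomial:
  "poly (ffact_basis a k) x = fact k * (x gchoose k) / pochhammer a k"
  by (simp add: poly_ffact_basis gbinomial_prod_rev atLeast0LessThan)

lemma poly_ffact_basis_pochhammer:
  "poly (ffact_basis a k) x = (-1) ^ k * pochhammer (-x) k / pochhammer a k"
  by (simp add: poly_ffact_basis_gbinomial gbinomial_pochhammer)

lemma ffact_basis_expansion:
  assumes "a > 0"
  shows "P = (\<Sum>k\<le>degree (L_op a P). smult (coeff (L_op a P) k) (ffact_basis a k))"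
proof -
  obtain n c where P: "P = (\<Sum>k\<le>n. smult (c k) (ffact_basis a k))"
    using ffact_basis_spans[OF assms] by blast
  have L: "L_op a P = (\<Sum>k\<le>n. monom (c k) k)"
    unfolding P by (rule L_op_expansion[OF assms])
  have co: "coeff (L_op a P) k = (if k \<le> n then c k else 0)" for k
    by (simp add: L coeff_sum)
  have deg: "degree (L_op a P) \<le> n"
    by (rule degree_le) (simp add: co)
  have "P = (\<Sum>k\<le>n. smult (coeff (L_op a P) k) (ffact_basis a k))"
    by (subst P) (simp add: co)
  also have "\<dots> = (\<Sum>k\<le>degree (L_op a P). smult (coeff (L_op a P) k) (ffact_basis a k))"
    using deg by (intro sum.mono_neutral_right) (auto simp: coeff_eq_0)
  finally show ?thesis .
qed

lemma L_op_ffact_basis: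
  assumes "a > 0"
  shows "L_op a (ffact_basis a k) = monom 1 k"
proof -
  have "ffact_basis a k = (\<Sum>j\<le>k. smult (if j = k then 1 else 0) (ffact_basis a j))"
    by (simp add: if_distrib[of "\<lambda>t. smult t _"] cong: if_cong)
  also have "L_op a \<dots> = (\<Sum>j\<le>k. monom (if j = k then 1 else 0) j)"
    by (rule L_op_expansion[OF assms])
  also have "\<dots> = (\<Sum>j\<le>k. if j = k then monom 1 j else 0)"
    by (intro sum.cong) auto
  also have "\<dots> = monom 1 k" by simp
  finally show ?thesis .
qed

lemma L_op_sum:
  assumes "a > 0"
  shows "L_op a (\<Sum>k\<in>A. f k) = (\<Sum>k\<in>A. L_op a (f k))"
proof -
  have "L_op a 0 = 0" using L_op_smult[OF assms, of 0 0] by simp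
  then show ?thesis
    by (induction A rule: infinite_finite_induct) (simp_all add: L_op_add[OF assms])
qed

text \<open>
  This is Chu-Vandermonde in the form
  \<open>(x+a)_k = (\<Sum>j\<le>k. (k choose j) * x (x-1) \<dots> (x-j+1) * (a+j)_(k-j))\<close>, divided by
  \<open>(a)_k = (a)_j (a+j)_(k-j)\<close>.
\<close>
lemma ffact_basis_reflect:
  assumes "a > 0"
  shows "pcompose (ffact_basis a k) [:-a, -1:] =
    smult ((-1) ^ k) (\<Sum>j\<le>k. smult (of_nat (k choose j)) (ffact_basis a j))"
proof (rule poly_eq_poly_eq_iff[THEN iffD1], rule ext)
  fix x :: real
  have summand: "fact k * ((x gchoose j) * ((a + real k - 1) gchoose (k - j))) / pochhammer a k =
      of_nat (k choose j) * poly (ffact_basis a j) x" if "j \<le> k" for j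
  proof -
    have "(a + real k - 1) gchoose (k - j) = pochhammer (a + real j) (k - j) / fact (k - j)"
      using that by (simp add: gbinomial_pochhammer' of_nat_diff algebra_simps)
    moreover have "pochhammer a k = pochhammer a j * pochhammer (a + real j) (k - j)"
      by (rule pochhammer_product[OF that])
    moreover have "pochhammer a j > 0" "pochhammer (a + real j) (k - j) > 0"
      using assms by (auto intro!: pochhammer_pos)
    ultimately show ?thesis
      using that by (simp add: poly_ffact_basis_gbinomial binomial_fact field_simps)
  qed
  have "poly (pcompose (ffact_basis a k) [:-a, -1:]) x =
      (-1) ^ k * (pochhammer (x + a) k / pochhammer a k)"
    by (simp add: poly_pcompose poly_ffact_basis_pochhammer add.commute)
  also have "pochhammer (x + a) k = fact k * ((x + (a + real k - 1)) gchoose k)"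
    by (simp add: gbinomial_pochhammer' algebra_simps)
  also have "\<dots> = (\<Sum>j\<le>k. fact k * ((x gchoose j) * ((a + real k - 1) gchoose (k - j))))"
    by (simp add: sum_distrib_left atLeast0AtMost flip: gbinomial_Vandermonde)
  also have "\<dots> / pochhammer a k = (\<Sum>j\<le>k. of_nat (k choose j) * poly (ffact_basis a j) x)"
    unfolding sum_divide_distrib by (intro sum.cong refl summand) simp
  finally show "poly (pcompose (ffact_basis a k) [:-a, -1:]) x =
      poly (smult ((-1) ^ k) (\<Sum>j\<le>k. smult (of_nat (k choose j)) (ffact_basis a j))) x"
    by (simp add: poly_sum)
qed

text \<open>
  By linearity it suffices to treat a basis polynomial, where \<open>ffact_basis_reflect\<close> turns into the
  binomial expansion of \<open>(-1-x)^k\<close>.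
\<close>
lemma L_op_reflect:
  assumes "a > 0"
  shows "L_op a (pcompose P [:-a, -1:]) = pcompose (L_op a P) [:-1, -1:]"
proof -
  have basis: "L_op a (pcompose (ffact_basis a k) [:-a, -1:]) = pcompose (monom 1 k) [:-1, -1:]"
    for k
  proof (rule poly_eq_poly_eq_iff[THEN iffD1], rule ext)
    fix x :: real
    have "poly (L_op a (pcompose (ffact_basis a k) [:-a, -1:])) x =
        (-1) ^ k * (\<Sum>j\<le>k. of_nat (k choose j) * x ^ j)"
      by (simp add: ffact_basis_reflect[OF assms] L_op_smult[OF assms] L_op_sum[OF assms]
          L_op_ffact_basis[OF assms] poly_sum poly_monom)
    also have "\<dots> = (-1) ^ k * (x + 1) ^ k"
      by (simp add: binomial_ring)
    also have "\<dots> = ((-1) * (x + 1)) ^ k"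
      by (simp only: power_mult_distrib)
    also have "(-1) * (x + 1) = -1 - x" by simp
    finally show "poly (L_op a (pcompose (ffact_basis a k) [:-a, -1:])) x =
        poly (pcompose (monom 1 k) [:-1, -1:]) x"
      by (simp add: poly_pcompose poly_monom)
  qed
  obtain n c where P: "P = (\<Sum>k\<le>n. smult (c k) (ffact_basis a k))"
    using ffact_basis_spans[OF assms] by blast
  show ?thesis
    by (simp add: P pcompose_sum pcompose_smult L_op_sum[OF assms] L_op_smult[OF assms] basis
        L_op_ffact_basis[OF assms])
qed

section \<open>Zeros at natural numbers\<close>

text \<open>
  A vanishing sum of nonnegative terms vanishes termwise, and at \<open>k\<close> the basis polynomials of index at
  most \<open>k\<close> are nonzero. So the expansion of \<open>P\<close> starts beyond index \<open>k\<close>, where every basis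
  polynomial has the factor \<open>x - j\<close>.
\<close>
lemma L_op_coeff_nonneg_zeros_downward:
  assumes "a > 0" and nonneg: "\<And>i. coeff (L_op a P) i \<ge> 0"
    and zero: "poly P (real k) = 0" and "j \<le> k"
  shows "poly P (real j) = 0"
proof -
  let ?c = "coeff (L_op a P)" and ?n = "degree (L_op a P)"
  have eval: "poly P x = (\<Sum>i\<le>?n. ?c i * poly (ffact_basis a i) x)" for x
    by (subst ffact_basis_expansion[OF \<open>a > 0\<close>]) (simp add: poly_sum)
  have basis: "poly (ffact_basis a i) (real k) \<ge> 0" for i
  proof -
    have "poly (ffact_basis a i) (real k) = fact i * real (k choose i) / pochhammer a i"
      by (simp add: poly_ffact_basis_gbinomial binomial_gbinomial)
    then show ?thesis using pochhammer_pos[OF \<open>a > 0\<close>, of i] by simp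
  qed
  have basis_neq: "poly (ffact_basis a i) (real k) \<noteq> 0" if "i \<le> k" for i
    using that pochhammer_pos[OF \<open>a > 0\<close>, of i] by (auto simp: poly_ffact_basis)
  have "\<forall>i\<in>{..?n}. ?c i * poly (ffact_basis a i) (real k) = 0"
    using zero unfolding eval by (subst (asm) sum_nonneg_eq_0_iff) (auto simp: nonneg basis)
  then have c0: "?c i = 0" if "i \<le> ?n" "i \<le> k" for i
    using that basis_neq by auto
  show ?thesis
    unfolding eval
  proof (rule sum.neutral, rule ballI)
    fix i assume "i \<in> {..?n}"
    then show "?c i * poly (ffact_basis a i) (real j) = 0"
      using c0[of i] \<open>j \<le> k\<close> by (cases "j < i") (auto simp: ffact_basis_eval_eq_0)
  qed
qed

section \<open>Values at the points \<open>-a-m\<close>\<close>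

text \<open>
  The powers have arbitrary real exponents, so termwise differentiation is confined to the open
  half-line. The falling product of exponents is written as a rising factorial to match the values of
  the basis polynomials at negative arguments.
\<close>
lemma higher_deriv_sum_powr:
  fixes d e :: "nat \<Rightarrow> real"
  assumes "\<And>x. x > 0 \<Longrightarrow> f x = (\<Sum>k\<in>A. d k * x powr e k)" and "x > 0"
  shows "(deriv ^^ m) f x =
    (\<Sum>k\<in>A. d k * pochhammer (e k - real m + 1) m * x powr (e k - real m))"
  using \<open>x > 0\<close>
proof (induction m arbitrary: x)
  case 0
  then show ?case by (simp add: assms(1))
next
  case (Suc m)
  let ?g = "\<lambda>x. \<Sum>k\<in>A. d k * pochhammer (e k - real m + 1) m * x powr (e k - real m)"
  let ?D = "\<Sum>k\<in>A. d k * pochhammer (e k - real m + 1) m *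
    ((e k - real m) * x powr (e k - real m - 1))"
  have "(?g has_real_derivative ?D) (at x)"
    by (intro DERIV_sum DERIV_cmult has_real_derivative_powr Suc.prems)
  then have "((deriv ^^ m) f has_real_derivative ?D) (at x)"
    by (rule has_field_derivative_transform_within_open[where S = "{0<..}"])
      (use Suc in auto)
  then have "(deriv ^^ Suc m) f x = ?D" by (simp add: DERIV_imp_deriv)
  also have "\<dots> = (\<Sum>k\<in>A. d k * pochhammer (e k - real (Suc m) + 1) (Suc m) *
      x powr (e k - real (Suc m)))"
    by (intro sum.cong refl) (simp add: pochhammer_rec algebra_simps)
  finally show ?case .
qed

lemma poly_at_minus_a_minus_nat:
  fixes a :: real
  assumes "a > 0"
  shows "poly (\<Sum>k\<le>n. smult (c k) (ffact_basis a k)) (- a - real m) =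
    1 / pochhammer a m *
      (deriv ^^ m) (\<lambda>x::real. x powr (a + real m - 1) *
        poly (pcompose (\<Sum>k\<le>n. monom (c k) k) [:0, -1:]) x) 1"
proof -
  have "(deriv ^^ m) (\<lambda>x::real. x powr (a + real m - 1) *
        poly (pcompose (\<Sum>k\<le>n. monom (c k) k) [:0, -1:]) x) 1 =
      (\<Sum>k\<le>n. c k * (-1) ^ k * pochhammer (a + real m - 1 + real k - real m + 1) m *
        1 powr (a + real m - 1 + real k - real m))"
  proof (rule higher_deriv_sum_powr)
    fix x :: real assume "x > 0"
    then show "x powr (a + real m - 1) *
        poly (pcompose (\<Sum>k\<le>n. monom (c k) k) [:0, -1:]) x =
      (\<Sum>k\<le>n. c k * (-1) ^ k * x powr (a + real m - 1 + real k))"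
      by (simp add: poly_pcompose poly_sum poly_monom sum_distrib_left powr_add powr_realpow
          power_minus[of x] mult_ac)
  qed simp
  also have "\<dots> = (\<Sum>k\<le>n. c k * (-1) ^ k * pochhammer (a + real k) m)"
    by (simp add: algebra_simps)
  finally have D: "(deriv ^^ m) (\<lambda>x::real. x powr (a + real m - 1) *
        poly (pcompose (\<Sum>k\<le>n. monom (c k) k) [:0, -1:]) x) 1 =
      (\<Sum>k\<le>n. c k * (-1) ^ k * pochhammer (a + real k) m)" .
  have swap: "pochhammer (a + real m) k / pochhammer a k = pochhammer (a + real k) m / pochhammer a m"
    for k
  proof -
    have "pochhammer a m * pochhammer (a + real m) k = pochhammer a k * pochhammer (a + real k) m"
      by (metis add.commute pochhammer_product')
    then show ?thesis
      using pochhammer_pos[OF assms, of k] pochhammer_pos[OF assms, of m]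
      by (simp add: field_simps)
  qed
  have "poly (\<Sum>k\<le>n. smult (c k) (ffact_basis a k)) (- a - real m) =
      (\<Sum>k\<le>n. c k * (-1) ^ k * (pochhammer (a + real m) k / pochhammer a k))"
    by (simp add: poly_sum poly_ffact_basis_pochhammer add.commute mult_ac)
  also have "\<dots> = 1 / pochhammer a m * (\<Sum>k\<le>n. c k * (-1) ^ k * pochhammer (a + real k) m)"
    unfolding swap by (simp add: sum_divide_distrib)
  finally show ?thesis unfolding D .
qed

section \<open>Zeros and values of \<open>P\<close>\<close>

theorem theorem3p2:
  fixes a :: real and c :: "nat \<Rightarrow> real" and n :: nat and P Q Qt :: "real poly"
  assumes "a > 0"
    and "P = (\<Sum>k\<le>n. smult (c k) (ffact_basis a k))"
    and "c n > 0"
    and "Q = L_op a P"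
    and "\<forall>z::complex. poly (map_poly complex_of_real Q) z = 0 \<longrightarrow> z \<in> complex_of_real ` {-1..0}"
    and "Qt = pcompose Q [:0, -1:]"
  shows "(\<forall>k\<in>{1..<n}. poly P (real k) = 0 \<longrightarrow> (\<forall>j<k. poly P (real j) = 0)) \<and>
         (\<forall>m::nat. m \<ge> 1 \<longrightarrow>
            poly P (- a - real m) =
              1 / (pochhammer a m * 1 powr (a - 1)) *
                (deriv ^^ m) (\<lambda>x::real. x powr (a + real m - 1) * poly Qt x) 1) \<and>
         (\<forall>l::nat. l \<ge> 1 \<longrightarrow> poly P (- a - real l) = 0 \<longrightarrow>
            (\<forall>j<l. poly P (- a - real j) = 0)) \<and>
         (\<forall>l::nat. degree P = 2 * l + 1 \<longrightarrow> (\<exists>x\<in>{-a..0}. poly P x = 0))"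
proof -
  have Q: "Q = (\<Sum>k\<le>n. monom (c k) k)"
    unfolding assms(2,4) by (rule L_op_expansion[OF assms(1)])
  have coQ: "coeff Q k = (if k \<le> n then c k else 0)" for k
    by (simp add: Q coeff_sum)
  have degQ: "degree Q = n"
    by (rule antisym[OF degree_le le_degree]) (use assms(3) in \<open>auto simp: coQ\<close>)
  have lcQ: "lead_coeff Q \<ge> 0" using assms(3) by (simp add: degQ coQ)
  note nonneg = roots_in_unit_segment_coeff_nonneg[OF assms(5) lcQ]

  \<comment> \<open>The sign makes the coefficients of the image of \<open>R\<close> nonnegative, so that what is known at the
    points \<open>j\<close> for \<open>P\<close> transfers to the points \<open>-a-j\<close> through \<open>R\<close>.\<close>
  define R where "R = smult ((-1) ^ n) (pcompose P [:-a, -1:])"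
  have polyR: "poly R x = (-1) ^ n * poly P (- a - x)" for x
    by (simp add: R_def poly_pcompose)
  have "L_op a R = smult ((-1) ^ degree Q) (pcompose Q [:-1, -1:])"
    unfolding R_def degQ unfolding assms(4)
    by (simp add: L_op_smult[OF assms(1)] L_op_reflect[OF assms(1)])
  then have nonnegR: "coeff (L_op a R) k \<ge> 0" for k
    using nonneg(2)[of k] by simp

  have value_0: "poly p 0 = coeff (L_op a p) 0" for p
  proof -
    have "poly (ffact_basis a k) 0 = (if k = 0 then 1 else 0)" for k
      by (auto simp: poly_ffact_basis)
    note basis_0 = this
    show ?thesis
      by (subst (1) ffact_basis_expansion[OF assms(1)])
        (simp add: poly_sum basis_0 if_distrib cong: if_cong)
  qed

  have 1: "poly P (real j) = 0" if "poly P (real k) = 0" "j < k" for j k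
    using L_op_coeff_nonneg_zeros_downward[OF assms(1), of P k j] nonneg(1) that assms(4) by simp
  have 2: "poly P (- a - real m) = 1 / (pochhammer a m * 1 powr (a - 1)) *
      (deriv ^^ m) (\<lambda>x::real. x powr (a + real m - 1) * poly Qt x) 1" for m
    using poly_at_minus_a_minus_nat[OF assms(1), where n = n and c = c and m = m] unfolding assms(2,6) Q by simp
  have 3: "poly P (- a - real j) = 0" if "poly P (- a - real l) = 0" "j < l" for j l
    using L_op_coeff_nonneg_zeros_downward[OF assms(1) nonnegR, of l j] that by (simp add: polyR)
  have 4: "\<exists>x\<in>{-a..0}. poly P x = 0" if "degree P = 2 * l + 1" for l
  proof -
    have "degree P \<le> n"
      unfolding assms(2)
      by (intro degree_sum_le) (auto intro: order.trans[OF degree_smult_le]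
          simp: degree_ffact_basis[OF assms(1)])
    moreover have "coeff P n \<noteq> 0"
    proof -
      have "coeff P n = (\<Sum>k\<in>{n}. c k * coeff (ffact_basis a k) n)"
        unfolding assms(2) coeff_sum coeff_smult
        by (rule sum.mono_neutral_right)
          (auto intro!: coeff_eq_0 simp: degree_ffact_basis[OF assms(1)])
      moreover have "ffact_basis a n \<noteq> 0"
        using ffact_basis_eval_neq_0[OF assms(1), of n] by auto
      ultimately show ?thesis
        using assms(3) degree_ffact_basis[OF assms(1), of n]
        by (simp flip: leading_coeff_0_iff)
    qed
    then have "n \<le> degree P" by (rule le_degree)
    ultimately have "odd n" using that by simp
    then have "poly P (- a) \<le> 0"
      using value_0[of R] nonnegR[of 0] polyR[of 0] by simp
    moreover have "poly P 0 \<ge> 0"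
      using value_0[of P] nonneg(1)[of 0] assms(4) by simp
    ultimately obtain x where "- a \<le> x" "x \<le> 0" "poly P x = 0"
      using IVT'[of "poly P" "- a" 0 0] assms(1) continuous_on_poly[OF continuous_on_id] by auto
    then show ?thesis by auto
  qed
  show ?thesis using 1 2 3 4 by blast
qed

end
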